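(* Let $I$ and $J$ be arbitrary (possibly infinite) index sets. Let $M=\prod_{i\in I}M_i$, where the $M_i$ are nontrivial monoids with zero satisfying $\mathrm{CCE}(M_i)=\{0,1\}$ for each $i\in I$. Let $$F=(f_j)_{j\in J}:M\to\prod_{j\in J}A_j$$ be a product decomposition of $M$ with every $A_j$ a nontrivial monoid. Then there is a unique partition $I=\bigsqcup_{j\in J}S_j$ and isomorphisms $\theta_j:A_j\to M_{S_j}$ ($j\in J$) such that $$\theta_j\circ f_j=\pi_{S_j}$$ for every $j\in J$.
   Context: A monoid with zero is a monoid with an absorbing element $0$ ($0x=x0=0$ for all $x$); a monoid is nontrivial if it has more than one element. For a monoid $M$, $\mathrm{CE}(M)=\{e\in M: e^2=e,\ ex=xe\ \text{for all }x\in M\}$ is the set of central idempotents, partially ordered by $e\le f\iff ef=e$. If $M$ has a zero, $e\in\mathrm{CE}(M)$ is complemented if there is $f\in\mathrm{CE}(M)$ such that $ef=0$ and $1$ is the unique common upper bound of $e$ and $f$ in $\mathrm{CE}(M)$; $\mathrm{CCE}(M)$ denotes the set of complemented central idempotents. A family of monoid homomorphisms $(f_j:M\to A_j)_{j\in J}$ is a product decomposition of $M$ if the induced map $(f_j)_{j\in J}:M\to\prod_{j\in J}A_j$ is an isomorphism of monoids. For $S\subseteq I$, $M_S=\prod_{i\in S}M_i$ (with $M_\varnothing$ the trivial monoid), and $\pi_S:M\to M_S$ is the coordinate projection. *)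

theory Defs
  imports "HOL-Algebra.Algebra" "HOL-Library.Disjoint_Sets"
begin

locale monoid_with_zero = monoid M for M (structure) +
  fixes z
  assumes zero_closed: "z \<in> carrier M"
    and zero_left: "x \<in> carrier M \<Longrightarrow> z \<otimes> x = z"
    and zero_right: "x \<in> carrier M \<Longrightarrow> x \<otimes> z = z"

definition nontrivial_monoid :: "('a, 'm) monoid_scheme \<Rightarrow> bool" where
  "nontrivial_monoid M \<longleftrightarrow> (\<exists>x\<in>carrier M. \<exists>y\<in>carrier M. x \<noteq> y)"

definition CE :: "('a, 'm) monoid_scheme \<Rightarrow> 'a set" where
  "CE M = {e \<in> carrier M. e \<otimes>\<^bsub>M\<^esub> e = e \<and> (\<forall>x\<in>carrier M. e \<otimes>\<^bsub>M\<^esub> x = x \<otimes>\<^bsub>M\<^esub> e)}"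

definition CE_le :: "('a, 'm) monoid_scheme \<Rightarrow> 'a \<Rightarrow> 'a \<Rightarrow> bool" where
  "CE_le M e f \<longleftrightarrow> e \<otimes>\<^bsub>M\<^esub> f = e"

text \<open>The argument \<open>z\<close> is the (necessarily unique) zero of \<open>M\<close>; the definition is only
  meaningful under \<^locale>\<open>monoid_with_zero\<close>.\<close>

definition CCE :: "('a, 'm) monoid_scheme \<Rightarrow> 'a \<Rightarrow> 'a set" where
  "CCE M z = {e \<in> CE M. \<exists>f\<in>CE M. e \<otimes>\<^bsub>M\<^esub> f = z \<and>
      {u \<in> CE M. CE_le M e u \<and> CE_le M f u} = {\<one>\<^bsub>M\<^esub>}}"

text \<open>The library's \<^const>\<open>hom\<close> does not require preservation of the unit, so this is added here.
  For bijective homomorphisms of monoids it is automatic, so isomorphisms of monoids are given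
  by \<^const>\<open>iso\<close>. Despite its name, \<^const>\<open>product_group\<close> is the componentwise product of
  arbitrary monoids; its elements are functions that are \<^const>\<open>undefined\<close> outside the index set.\<close>

definition monoid_hom :: "('a, 'm) monoid_scheme \<Rightarrow> ('b, 'n) monoid_scheme \<Rightarrow> ('a \<Rightarrow> 'b) set" where
  "monoid_hom M N = {h \<in> hom M N. h \<one>\<^bsub>M\<^esub> = \<one>\<^bsub>N\<^esub>}"

definition product_decomposition ::
    "('a, 'm) monoid_scheme \<Rightarrow> 'j set \<Rightarrow> ('j \<Rightarrow> ('b, 'n) monoid_scheme) \<Rightarrow> ('j \<Rightarrow> 'a \<Rightarrow> 'b) \<Rightarrow> bool" where
  "product_decomposition M J A f \<longleftrightarrow>
     (\<forall>j\<in>J. f j \<in> monoid_hom M (A j)) \<and>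
     (\<lambda>x. \<lambda>j\<in>J. f j x) \<in> iso M (product_group J A)"

definition indexed_partition :: "'i set \<Rightarrow> 'j set \<Rightarrow> ('j \<Rightarrow> 'i set) \<Rightarrow> bool" where
  "indexed_partition I J S \<longleftrightarrow>
     (\<Union>j\<in>J. S j) = I \<and> disjoint_family_on S J \<and> (\<forall>j\<in>J. S j \<noteq> {})"

end

theory Submission
  imports Defs
begin

text \<open>
  Complemented central idempotents of a product of monoids are complemented in each coordinate.
  The idempotent of \<open>\<Prod>\<^sub>j A\<^sub>j\<close> that is \<open>1\<close> at \<open>j\<close> and \<open>0\<close> elsewhere is complemented and central,
  so its preimage \<open>e\<^sub>j\<close> in \<open>\<Prod>\<^sub>i M\<^sub>i\<close> has all coordinates in \<open>{0, 1}\<close>; put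
  \<open>S\<^sub>j = {i. e\<^sub>j(i) \<noteq> 0}\<close>. Then \<open>f\<^sub>j x = f\<^sub>j y\<close> iff \<open>e\<^sub>j x = e\<^sub>j y\<close> iff \<open>x\<close> and \<open>y\<close> agree on \<open>S\<^sub>j\<close>,
  which yields \<open>\<theta>\<^sub>j\<close>. Orthogonality of the \<open>e\<^sub>j\<close> makes the \<open>S\<^sub>j\<close> disjoint. If \<open>i\<close> lay in no \<open>S\<^sub>j\<close>,
  the element that is \<open>0\<close> at \<open>i\<close> and \<open>1\<close> elsewhere would have the same image under every
  \<open>f\<^sub>j\<close> as \<open>1\<close>. The same element detects membership \<open>i \<in> S\<^sub>j\<close>, whence uniqueness.
\<close>

section \<open>Central idempotents of a product, coordinate by coordinate\<close>

lemma CE_product_group_component: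
  assumes e: "e \<in> CE (product_group I M)" and i: "i \<in> I"
  shows "e i \<in> CE (M i)"
proof -
  have c: "e \<in> (\<Pi>\<^sub>E i\<in>I. carrier (M i))" and id: "(\<lambda>i\<in>I. e i \<otimes>\<^bsub>M i\<^esub> e i) = e"
    and comm: "\<And>x. x \<in> (\<Pi>\<^sub>E i\<in>I. carrier (M i)) \<Longrightarrow>
      (\<lambda>i\<in>I. e i \<otimes>\<^bsub>M i\<^esub> x i) = (\<lambda>i\<in>I. x i \<otimes>\<^bsub>M i\<^esub> e i)"
    using e by (auto simp: CE_def)
  have "e i \<otimes>\<^bsub>M i\<^esub> y = y \<otimes>\<^bsub>M i\<^esub> e i" if y: "y \<in> carrier (M i)" for y
  proof -
    \<comment> \<open>Away from \<open>i\<close> the test tuple copies \<open>e\<close>, which keeps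
      it in the product; commuting with it, read at \<open>i\<close>, is commuting with
      \<open>y\<close>.\<close>
    have "(\<lambda>k\<in>I. if k = i then y else e k) \<in> (\<Pi>\<^sub>E i\<in>I. carrier (M i))"
      using c y by auto
    from fun_cong [OF comm [OF this], of i] i show ?thesis by simp
  qed
  moreover have "e i \<otimes>\<^bsub>M i\<^esub> e i = e i" using fun_cong [OF id, of i] i by simp
  ultimately show ?thesis using c i by (auto simp: CE_def)
qed

lemma CE_product_groupI:
  assumes "e \<in> extensional I" and "\<And>i. i \<in> I \<Longrightarrow> e i \<in> CE (M i)"
  shows "e \<in> CE (product_group I M)"
proof -
  have e: "e i \<in> carrier (M i)" "e i \<otimes>\<^bsub>M i\<^esub> e i = e i" if "i \<in> I" for i
    using assms(2) [OF that] by (simp_all add: CE_def)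
  have comm: "e i \<otimes>\<^bsub>M i\<^esub> y = y \<otimes>\<^bsub>M i\<^esub> e i" if "i \<in> I" "y \<in> carrier (M i)" for i y
    using assms(2) [OF that(1)] that(2) by (simp add: CE_def)
  have "e \<in> carrier (product_group I M)" using e(1) assms(1) by (simp add: PiE_iff)
  moreover have "e \<otimes>\<^bsub>product_group I M\<^esub> e = e"
    using e(2) assms(1) by (intro extensionalityI [of _ I]) auto
  moreover have "e \<otimes>\<^bsub>product_group I M\<^esub> x = x \<otimes>\<^bsub>product_group I M\<^esub> e"
    if "x \<in> carrier (product_group I M)" for x
    using that comm by (auto simp: PiE_iff intro!: restrict_ext)
  ultimately show ?thesis
    unfolding CE_def by blast
qed

lemma one_in_CE: "monoid M \<Longrightarrow> \<one>\<^bsub>M\<^esub> \<in> CE M"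
  by (simp add: CE_def monoid.l_one monoid.r_one monoid.one_closed)

text \<open>If \<open>g\<close> is a complement of \<open>e\<close>, then \<open>g i\<close> is one
  of \<open>e i\<close>: a common upper bound of \<open>e i\<close> and \<open>g i\<close>, padded
  with units in the other coordinates, is a common upper bound of \<open>e\<close> and
  \<open>g\<close>, hence the unit.\<close>

lemma CCE_product_group_component:
  assumes mon: "\<And>i. i \<in> I \<Longrightarrow> monoid (M i)"
    and e: "e \<in> CCE (product_group I M) (\<lambda>i\<in>I. z i)" and i: "i \<in> I"
  shows "e i \<in> CCE (M i) (z i)"
proof -
  let ?P = "product_group I M"
  obtain g where eC: "e \<in> CE ?P" and gC: "g \<in> CE ?P" and eg: "e \<otimes>\<^bsub>?P\<^esub> g = (\<lambda>i\<in>I. z i)"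
    and ub: "{u \<in> CE ?P. CE_le ?P e u \<and> CE_le ?P g u} = {\<one>\<^bsub>?P\<^esub>}"
    using e by (auto simp: CCE_def)
  have comp: "e k \<in> CE (M k)" "g k \<in> CE (M k)" if "k \<in> I" for k
    using CE_product_group_component [OF eC that] CE_product_group_component [OF gC that] .
  have ext: "a \<in> extensional I" if "a \<in> CE ?P" for a
    using that by (simp add: CE_def PiE_def)
  have "v = \<one>\<^bsub>M i\<^esub>" if v: "v \<in> CE (M i)" "CE_le (M i) (e i) v" "CE_le (M i) (g i) v" for v
  proof -
    let ?u = "\<lambda>k\<in>I. if k = i then v else \<one>\<^bsub>M k\<^esub>"
    have "?u \<in> CE ?P"
      by (rule CE_product_groupI) (use v mon one_in_CE in auto)
    moreover have "CE_le ?P a ?u"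
      if "a \<in> extensional I" "\<And>k. k \<in> I \<Longrightarrow> a k \<in> CE (M k)" "CE_le (M i) (a i) v" for a
      using that mon by (auto simp: CE_le_def fun_eq_iff extensional_def CE_def monoid.r_one)
    then have "CE_le ?P e ?u" "CE_le ?P g ?u"
      using comp ext [OF eC] ext [OF gC] v by auto
    ultimately have "?u = \<one>\<^bsub>?P\<^esub>"
      using ub by blast
    from fun_cong [OF this, of i] i show ?thesis by simp
  qed
  moreover have "CE_le (M i) (e i) \<one>\<^bsub>M i\<^esub>" "CE_le (M i) (g i) \<one>\<^bsub>M i\<^esub>"
    using comp [OF i] mon [OF i] by (auto simp: CE_le_def CE_def monoid.r_one)
  moreover have "e i \<otimes>\<^bsub>M i\<^esub> g i = z i"
    using fun_cong [OF eg, of i] i by simp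
  ultimately show ?thesis
    using comp [OF i] one_in_CE [OF mon [OF i]] unfolding CCE_def by blast
qed

section \<open>Transport of central idempotents along isomorphisms\<close>

lemma CE_iso_iff:
  assumes F: "F \<in> iso M N" and x: "x \<in> carrier M" and M: "monoid M"
  shows "F x \<in> CE N \<longleftrightarrow> x \<in> CE M"
proof -
  have mult: "\<And>a b. a \<in> carrier M \<Longrightarrow> b \<in> carrier M \<Longrightarrow> F (a \<otimes>\<^bsub>M\<^esub> b) = F a \<otimes>\<^bsub>N\<^esub> F b"
    and inj: "inj_on F (carrier M)" and im: "F ` carrier M = carrier N"
    using F by (auto simp: iso_def hom_def bij_betw_def)
  \<comment> \<open>Injectivity makes \<open>F\<close> reflect equations between products;
    surjectivity then turns quantification over \<open>N\<close> into quantification over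
    \<open>M\<close>.\<close>
  have eq: "F a \<otimes>\<^bsub>N\<^esub> F b = F c \<otimes>\<^bsub>N\<^esub> F d \<longleftrightarrow> a \<otimes>\<^bsub>M\<^esub> b = c \<otimes>\<^bsub>M\<^esub> d"
    if "a \<in> carrier M" "b \<in> carrier M" "c \<in> carrier M" "d \<in> carrier M" for a b c d
    using that inj M by (simp add: mult [symmetric] inj_on_eq_iff monoid.m_closed)
  have "F x \<otimes>\<^bsub>N\<^esub> F x = F x \<longleftrightarrow> x \<otimes>\<^bsub>M\<^esub> x = x"
    using x inj M by (simp add: mult [symmetric] inj_on_eq_iff monoid.m_closed)
  then show ?thesis
    using x eq by (auto simp: CE_def im [symmetric])
qed

lemma CCE_iso_reflect:
  assumes F: "F \<in> iso M N" and M: "monoid M" and N: "monoid N"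
    and z: "z \<in> carrier M" and e: "e \<in> carrier M" "F e \<in> CCE N (F z)"
  shows "e \<in> CCE M z"
proof -
  have mult: "\<And>a b. a \<in> carrier M \<Longrightarrow> b \<in> carrier M \<Longrightarrow> F (a \<otimes>\<^bsub>M\<^esub> b) = F a \<otimes>\<^bsub>N\<^esub> F b"
    and inj: "inj_on F (carrier M)" and im: "F ` carrier M = carrier N"
    using F by (auto simp: iso_def hom_def bij_betw_def)
  \<comment> \<open>\<open>iso\<close> only records multiplicativity. With \<open>F u\<close> the
    unit of \<open>N\<close>, applying \<open>F\<close> to the product of the unit of
    \<open>M\<close> and \<open>u\<close> gives the claim.\<close>
  have one: "F \<one>\<^bsub>M\<^esub> = \<one>\<^bsub>N\<^esub>"
  proof -
    obtain u where "u \<in> carrier M" "F u = \<one>\<^bsub>N\<^esub>"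
      using monoid.one_closed [OF N] unfolding im [symmetric] by auto
    moreover have "F \<one>\<^bsub>M\<^esub> \<in> carrier N" using monoid.one_closed [OF M] im by blast
    ultimately show ?thesis
      using mult [of "\<one>\<^bsub>M\<^esub>" u] M N by (simp add: monoid.l_one monoid.r_one monoid.one_closed)
  qed
  have le: "CE_le N (F a) (F b) \<longleftrightarrow> CE_le M a b" if "a \<in> carrier M" "b \<in> carrier M" for a b
    using that inj M by (simp add: CE_le_def mult [symmetric] inj_on_eq_iff monoid.m_closed)
  obtain g' where g': "g' \<in> CE N" "F e \<otimes>\<^bsub>N\<^esub> g' = F z"
    "{u \<in> CE N. CE_le N (F e) u \<and> CE_le N g' u} = {\<one>\<^bsub>N\<^esub>}" and eC: "F e \<in> CE N"
    using e by (auto simp: CCE_def)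
  obtain g where g: "g \<in> carrier M" "g' = F g"
    using g'(1) im by (auto simp: CE_def)
  have "e \<otimes>\<^bsub>M\<^esub> g = z"
    using g'(2) g e z M inj by (simp add: mult [symmetric] inj_on_eq_iff monoid.m_closed)
  moreover have "{u \<in> CE M. CE_le M e u \<and> CE_le M g u} = {\<one>\<^bsub>M\<^esub>}"
  proof -
    have "u \<in> CE M \<and> CE_le M e u \<and> CE_le M g u \<longleftrightarrow> F u = F \<one>\<^bsub>M\<^esub>" if "u \<in> carrier M" for u
    proof -
      have "F u \<in> CE N \<and> CE_le N (F e) (F u) \<and> CE_le N (F g) (F u) \<longleftrightarrow> F u = \<one>\<^bsub>N\<^esub>"
        using g'(3) unfolding g(2) set_eq_iff by simp
      then show ?thesis
        by (simp only: CE_iso_iff [OF F that M] le [OF e(1) that] le [OF g(1) that] one)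
    qed
    then have "u \<in> CE M \<and> CE_le M e u \<and> CE_le M g u \<longleftrightarrow> u = \<one>\<^bsub>M\<^esub>" if "u \<in> carrier M" for u
      using that inj M by (simp add: inj_on_eq_iff monoid.one_closed)
    then show ?thesis using monoid.one_closed [OF M] by (auto simp: CE_def)
  qed
  ultimately show ?thesis
    using CE_iso_iff [OF F _ M] e g g'(1) eC by (auto simp: CCE_def)
qed

section \<open>Tuples of zeros and units\<close>

lemma zero_in_CE: "monoid_with_zero M z \<Longrightarrow> z \<in> CE M"
  by (simp add: CE_def monoid_with_zero.zero_closed monoid_with_zero.zero_left
      monoid_with_zero.zero_right)

text \<open>The complement arises by exchanging zeros and units. At each index one of the two tuples
  is the unit, and only the unit lies above the unit, so their only common upper bound is the
  unit.\<close>

lemma indicator_in_CCE_product_group: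
  assumes mz: "\<And>j. j \<in> J \<Longrightarrow> monoid_with_zero (A j) (w j)"
  shows "(\<lambda>k\<in>J. if k \<in> T then \<one>\<^bsub>A k\<^esub> else w k) \<in> CCE (product_group J A) (\<lambda>j\<in>J. w j)"
    (is "?c \<in> CCE ?P _")
proof -
  let ?d = "\<lambda>k\<in>J. if k \<in> T then w k else \<one>\<^bsub>A k\<^esub>"
  have mon: "monoid (A j)" if "j \<in> J" for j
    using mz [OF that] by (simp add: monoid_with_zero_def)
  have ce: "?c \<in> CE ?P" "?d \<in> CE ?P" "\<one>\<^bsub>?P\<^esub> \<in> CE ?P"
    by (rule CE_product_groupI; simp add: zero_in_CE [OF mz] one_in_CE [OF mon])+
  have "?c \<otimes>\<^bsub>?P\<^esub> ?d = (\<lambda>j\<in>J. w j)"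
    using mz by (auto simp: fun_eq_iff monoid.l_one [OF mon] monoid.r_one [OF mon]
        monoid_with_zero.zero_closed)
  moreover have "u = \<one>\<^bsub>?P\<^esub>" if u: "u \<in> CE ?P" "CE_le ?P ?c u" "CE_le ?P ?d u" for u
  proof -
    have uc: "u \<in> (\<Pi>\<^sub>E j\<in>J. carrier (A j))" using u(1) by (simp add: CE_def)
    have "u j = \<one>\<^bsub>A j\<^esub>" if j: "j \<in> J" for j
      using fun_cong [OF u(2) [unfolded CE_le_def], of j]
        fun_cong [OF u(3) [unfolded CE_le_def], of j] uc j mon [OF j]
      by (cases "j \<in> T") (auto simp: monoid.l_one PiE_iff)
    then show ?thesis using uc by (auto simp: fun_eq_iff PiE_iff extensional_def)
  qed
  moreover have "CE_le ?P ?c \<one>\<^bsub>?P\<^esub>" "CE_le ?P ?d \<one>\<^bsub>?P\<^esub>"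
    using mz mon by (auto simp: CE_le_def fun_eq_iff monoid.r_one monoid.one_closed
        monoid_with_zero.zero_closed)
  ultimately show ?thesis using ce unfolding CCE_def by blast
qed

section \<open>Surjections with the same fibres\<close>

text \<open>The homomorphism theorem for monoids: \<open>ker\<close> lets \<open>g\<close> factor
  through \<open>f\<close>, and also makes the factor injective. Extensionality of \<open>h\<close>
  prepares the uniqueness of the isomorphisms as functions.\<close>

lemma iso_of_same_kernel:
  assumes M: "monoid M"
    and f: "f \<in> hom M A" "f ` carrier M = carrier A"
    and g: "g \<in> hom M B" "g ` carrier M = carrier B"
    and ker: "\<And>x y. x \<in> carrier M \<Longrightarrow> y \<in> carrier M \<Longrightarrow> f x = f y \<longleftrightarrow> g x = g y"
  obtains h where "h \<in> iso A B" "h \<in> extensional (carrier A)"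
    "\<And>x. x \<in> carrier M \<Longrightarrow> h (f x) = g x"
proof -
  define h where "h = (\<lambda>a\<in>carrier A. g (inv_into (carrier M) f a))"
  have hf: "h (f x) = g x" if x: "x \<in> carrier M" for x
  proof -
    have "f x \<in> f ` carrier M" using x by blast
    \<comment> \<open>The preimage of \<open>f x\<close> chosen in \<open>h\<close> lies in the same
      fibre of \<open>f\<close> as \<open>x\<close>, so \<open>ker\<close> gives it the same value
      under \<open>g\<close>.\<close>
    then show ?thesis
      using ker [OF inv_into_into [of "f x" f] x] f(2) by (simp add: h_def f_inv_into_f)
  qed
  have "h \<in> hom A B"
  proof (rule homI)
    fix a assume "a \<in> carrier A"
    then show "h a \<in> carrier B" using f(2) g(2) hf by force
  next
    fix a b assume "a \<in> carrier A" "b \<in> carrier A"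
    then obtain x y where xy: "x \<in> carrier M" "y \<in> carrier M" "a = f x" "b = f y"
      using f(2) by blast
    then have "h (a \<otimes>\<^bsub>A\<^esub> b) = g (x \<otimes>\<^bsub>M\<^esub> y)"
      using f(1) M hf by (simp add: hom_mult [symmetric] monoid.m_closed)
    then show "h (a \<otimes>\<^bsub>A\<^esub> b) = h a \<otimes>\<^bsub>B\<^esub> h b"
      using g(1) xy hf by (simp add: hom_mult)
  qed
  moreover have "inj_on h (carrier A)"
    unfolding f(2) [symmetric] by (auto simp: inj_on_def hf ker)
  moreover have "h ` carrier A = carrier B"
    unfolding f(2) [symmetric] g(2) [symmetric] image_image by (simp add: hf)
  ultimately have "h \<in> iso A B" by (simp add: iso_def bij_betw_def)
  moreover have "h \<in> extensional (carrier A)" by (simp add: h_def)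
  ultimately show ?thesis using that hf by blast
qed

section \<open>Product monoids, restriction to coordinates, and zeros\<close>

lemma monoid_product_group:
  assumes "\<And>i. i \<in> I \<Longrightarrow> monoid (M i)"
  shows "monoid (product_group I M)"
  using assms
  by (intro monoidI)
    (auto simp: PiE_iff fun_eq_iff extensional_def monoid.m_closed monoid.one_closed
      monoid.m_assoc monoid.l_one monoid.r_one)

lemma restrict_hom_product_group:
  "S \<subseteq> I \<Longrightarrow> (\<lambda>x. restrict x S) \<in> hom (product_group I M) (product_group S M)"
  by (auto simp: hom_def PiE_iff fun_eq_iff subset_iff)

lemma restrict_image_product_group:
  assumes "S \<subseteq> I" and "\<And>i. i \<in> I \<Longrightarrow> monoid (M i)"
  shows "(\<lambda>x. restrict x S) ` carrier (product_group I M) = carrier (product_group S M)"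
proof
  show "(\<lambda>x. restrict x S) ` carrier (product_group I M) \<subseteq> carrier (product_group S M)"
    using assms(1) by (auto simp: PiE_iff)
  show "carrier (product_group S M) \<subseteq> (\<lambda>x. restrict x S) ` carrier (product_group I M)"
  proof
    fix y assume y: "y \<in> carrier (product_group S M)"
    have "(\<lambda>i\<in>I. if i \<in> S then y i else \<one>\<^bsub>M i\<^esub>) \<in> carrier (product_group I M)"
      using y assms(2) by (auto simp: monoid.one_closed)
    moreover have "y = restrict (\<lambda>i\<in>I. if i \<in> S then y i else \<one>\<^bsub>M i\<^esub>) S"
      using y assms(1) by (auto simp: fun_eq_iff PiE_iff extensional_def)
    ultimately show "y \<in> (\<lambda>x. restrict x S) ` carrier (product_group I M)" by blast
  qed
qed

lemma monoid_with_zero_product_group: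
  assumes "\<And>i. i \<in> I \<Longrightarrow> monoid_with_zero (M i) (z i)"
  shows "monoid_with_zero (product_group I M) (\<lambda>i\<in>I. z i)"
proof -
  have "monoid (product_group I M)"
    using assms by (intro monoid_product_group) (simp add: monoid_with_zero_def)
  then show ?thesis
    using assms
    by (auto simp: monoid_with_zero_def monoid_with_zero_axioms_def PiE_iff intro!: restrict_ext)
qed

text \<open>Every element of \<open>A\<close> is some \<open>f x\<close>, and \<open>f\<close> maps
  the zero laws for \<open>x\<close> to those for \<open>f x\<close>. This is where the factors of a
  decomposition get their zeros.\<close>

lemma monoid_with_zero_image:
  assumes M: "monoid_with_zero M z" and A: "monoid A"
    and f: "f \<in> hom M A" and surj: "f ` carrier M = carrier A"
  shows "monoid_with_zero A (f z)"
proof -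
  note z = monoid_with_zero.zero_closed [OF M]
  have "f z \<otimes>\<^bsub>A\<^esub> a = f z \<and> a \<otimes>\<^bsub>A\<^esub> f z = f z" if a: "a \<in> carrier A" for a
  proof -
    obtain x where x: "x \<in> carrier M" "a = f x"
      using a unfolding surj [symmetric] by blast
    show ?thesis
      using hom_mult [OF f z x(1)] hom_mult [OF f x(1) z]
      by (simp only: x(2) monoid_with_zero.zero_left [OF M x(1)]
          monoid_with_zero.zero_right [OF M x(1)])
  qed
  moreover have "f z \<in> carrier A" using z surj by blast
  ultimately show ?thesis
    using A by (simp add: monoid_with_zero_def monoid_with_zero_axioms_def)
qed

lemma nontrivial_zero_neq_one:
  assumes "monoid_with_zero M z" and "nontrivial_monoid M"
  shows "z \<noteq> \<one>\<^bsub>M\<^esub>"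
proof
  assume z: "z = \<one>\<^bsub>M\<^esub>"
  have M: "monoid M" using assms(1) by (simp add: monoid_with_zero_def)
  have "x = z" if "x \<in> carrier M" for x
    using monoid_with_zero.zero_left [OF assms(1) that] monoid.l_one [OF M that] z by simp
  then show False using assms(2) unfolding nontrivial_monoid_def by blast
qed

section \<open>Idempotents attached to a product decomposition\<close>

lemma product_decomposition_surj:
  assumes pd: "product_decomposition M J A f"
    and monA: "\<And>j. j \<in> J \<Longrightarrow> monoid (A j)" and j: "j \<in> J"
  shows "f j ` carrier M = carrier (A j)"
proof
  have imF: "(\<lambda>x. \<lambda>j\<in>J. f j x) ` carrier M = carrier (product_group J A)"
    using pd by (simp add: product_decomposition_def iso_def bij_betw_def)
  show "f j ` carrier M \<subseteq> carrier (A j)"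
    using pd j by (auto simp: product_decomposition_def monoid_hom_def hom_def)
  show "carrier (A j) \<subseteq> f j ` carrier M"
  proof
    fix a assume a: "a \<in> carrier (A j)"
    \<comment> \<open>Units complete \<open>a\<close> to a tuple; a preimage of that tuple is sent
      to \<open>a\<close> by \<open>f j\<close>.\<close>
    have "(\<lambda>k\<in>J. if k = j then a else \<one>\<^bsub>A k\<^esub>) \<in> carrier (product_group J A)"
      using a monA by (auto simp: monoid.one_closed)
    then obtain x where x: "x \<in> carrier M"
      "(\<lambda>k\<in>J. if k = j then a else \<one>\<^bsub>A k\<^esub>) = (\<lambda>j\<in>J. f j x)"
      unfolding imF [symmetric] by (rule imageE)
    from fun_cong [OF x(2), of j] j x(1) show "a \<in> f j ` carrier M" by auto
  qed
qed

text \<open>Multiplication by \<open>e\<close> keeps the component at \<open>j\<close> and replaces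
  all others by zero. Thus the product of \<open>e\<close> and \<open>x\<close> carries exactly the
  information in \<open>f j x\<close>.\<close>

lemma product_decomposition_idempotent:
  assumes pd: "product_decomposition M J A f" and mz: "monoid_with_zero M z"
    and monA: "\<And>j. j \<in> J \<Longrightarrow> monoid (A j)" and j: "j \<in> J"
  obtains e where "e \<in> CCE M z" "\<And>k. k \<in> J \<Longrightarrow> k \<noteq> j \<Longrightarrow> f k e = f k z"
    "\<And>x y. x \<in> carrier M \<Longrightarrow> y \<in> carrier M \<Longrightarrow>
      f j x = f j y \<longleftrightarrow> e \<otimes>\<^bsub>M\<^esub> x = e \<otimes>\<^bsub>M\<^esub> y"
proof -
  let ?P = "product_group J A"
  let ?F = "\<lambda>x. \<lambda>j\<in>J. f j x"
  have monM: "monoid M" using mz by (simp add: monoid_with_zero_def)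
  have zc: "z \<in> carrier M" using mz by (rule monoid_with_zero.zero_closed)
  have F: "?F \<in> iso M ?P" and fhom: "\<And>k. k \<in> J \<Longrightarrow> f k \<in> hom M (A k)"
    using pd by (simp_all add: product_decomposition_def monoid_hom_def)
  have injF: "inj_on ?F (carrier M)" and imF: "?F ` carrier M = carrier ?P"
    using F by (simp_all add: iso_def bij_betw_def)
  have zeroA: "monoid_with_zero (A k) (f k z)" if "k \<in> J" for k
    using mz monA [OF that] fhom [OF that] product_decomposition_surj [OF pd monA that]
    by (rule monoid_with_zero_image)
  \<comment> \<open>\<open>f k z\<close> is the zero of \<open>A k\<close>. The condition is written
    \<open>k \<in> {j}\<close> to match the set \<open>T\<close> of the indicator tuples.\<close>
  define c where "c = (\<lambda>k\<in>J. if k \<in> {j} then \<one>\<^bsub>A k\<^esub> else f k z)"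
  have c_CCE: "c \<in> CCE ?P (?F z)"
    unfolding c_def by (rule indicator_in_CCE_product_group [OF zeroA])
  then have "c \<in> carrier ?P" by (simp add: CCE_def CE_def)
  then obtain e where e: "e \<in> carrier M" "c = ?F e"
    unfolding imF [symmetric] by (rule imageE)
  have fe: "f k e = (if k = j then \<one>\<^bsub>A k\<^esub> else f k z)" if "k \<in> J" for k
    using fun_cong [OF e(2), of k] that by (simp add: c_def)
  have "e \<in> CCE M z"
    using CCE_iso_reflect [OF F monM monoid_product_group [OF monA] zc e(1)] c_CCE
    by (simp only: e(2))
  moreover have "f j x = f j y \<longleftrightarrow> e \<otimes>\<^bsub>M\<^esub> x = e \<otimes>\<^bsub>M\<^esub> y"
    if x: "x \<in> carrier M" and y: "y \<in> carrier M" for x y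
  proof -
    have f_mult: "f k (e \<otimes>\<^bsub>M\<^esub> v) = (if k = j then f k v else f k z)"
      if k: "k \<in> J" and v: "v \<in> carrier M" for k v
    proof -
      have "f k v \<in> carrier (A k)" using hom_in_carrier [OF fhom [OF k] v] .
      then show ?thesis
        using hom_mult [OF fhom [OF k] e(1) v] fe [OF k] monA [OF k] zeroA [OF k]
        by (cases "k = j") (simp_all add: monoid.l_one monoid_with_zero.zero_left)
    qed
    \<comment> \<open>Injectivity of the isomorphism reduces the equation to components; those other
      than \<open>j\<close> are \<open>f k z\<close> on both sides.\<close>
    have "e \<otimes>\<^bsub>M\<^esub> x = e \<otimes>\<^bsub>M\<^esub> y \<longleftrightarrow> ?F (e \<otimes>\<^bsub>M\<^esub> x) = ?F (e \<otimes>\<^bsub>M\<^esub> y)"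
      using inj_on_eq_iff [OF injF monoid.m_closed [OF monM e(1) x] monoid.m_closed [OF monM e(1) y]]
      by (rule sym)
    also have "\<dots> \<longleftrightarrow> f j x = f j y"
      using j f_mult [OF _ x] f_mult [OF _ y] by (auto simp: fun_eq_iff restrict_def)
    finally show ?thesis by simp
  qed
  ultimately show ?thesis using that fe by simp
qed

text \<open>Each \<open>e i\<close> is zero or the unit. Where it is zero, both products vanish and
  impose no condition; where it is the unit, the equation reads \<open>x i = y i\<close>.\<close>

lemma CCE_two_valued_mult_eq_iff:
  assumes mz: "\<And>i. i \<in> I \<Longrightarrow> monoid_with_zero (M i) (z i)"
    and CCE: "\<And>i. i \<in> I \<Longrightarrow> CCE (M i) (z i) \<subseteq> {z i, \<one>\<^bsub>M i\<^esub>}"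
    and e: "e \<in> CCE (product_group I M) (\<lambda>i\<in>I. z i)"
    and x: "x \<in> carrier (product_group I M)" and y: "y \<in> carrier (product_group I M)"
  shows "e \<otimes>\<^bsub>product_group I M\<^esub> x = e \<otimes>\<^bsub>product_group I M\<^esub> y \<longleftrightarrow>
    restrict x {i \<in> I. e i \<noteq> z i} = restrict y {i \<in> I. e i \<noteq> z i}"
proof -
  have eq: "e i \<otimes>\<^bsub>M i\<^esub> x i = e i \<otimes>\<^bsub>M i\<^esub> y i \<longleftrightarrow> (e i \<noteq> z i \<longrightarrow> x i = y i)" if i: "i \<in> I" for i
  proof -
    have mon: "monoid (M k)" if "k \<in> I" for k
      using mz [OF that] by (simp add: monoid_with_zero_def)
    have "e i \<in> {z i, \<one>\<^bsub>M i\<^esub>}"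
      using CCE_product_group_component [OF mon e i] CCE [OF i] by (rule rev_subsetD)
    moreover have "x i \<in> carrier (M i)" "y i \<in> carrier (M i)" using x y i by auto
    ultimately show ?thesis
      using mon [OF i] mz [OF i]
      by (cases "e i = z i") (simp_all add: monoid.l_one monoid_with_zero.zero_left)
  qed
  have "e \<otimes>\<^bsub>product_group I M\<^esub> x = e \<otimes>\<^bsub>product_group I M\<^esub> y \<longleftrightarrow>
      (\<forall>i\<in>I. e i \<otimes>\<^bsub>M i\<^esub> x i = e i \<otimes>\<^bsub>M i\<^esub> y i)"
    by (auto simp: fun_eq_iff restrict_def)
  also have "\<dots> \<longleftrightarrow> restrict x {i \<in> I. e i \<noteq> z i} = restrict y {i \<in> I. e i \<noteq> z i}"
    using eq by (auto simp: fun_eq_iff restrict_def)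
  finally show ?thesis .
qed

section \<open>Existence and uniqueness of the partition and the isomorphisms\<close>

theorem proposition3p9:
  fixes I :: "'i set" and J :: "'j set"
    and M :: "'i \<Rightarrow> ('a, 'm) monoid_scheme" and z :: "'i \<Rightarrow> 'a"
    and A :: "'j \<Rightarrow> ('b, 'n) monoid_scheme"
    and f :: "'j \<Rightarrow> ('i \<Rightarrow> 'a) \<Rightarrow> 'b"
  assumes "\<And>i. i \<in> I \<Longrightarrow> monoid_with_zero (M i) (z i)"
    and "\<And>i. i \<in> I \<Longrightarrow> nontrivial_monoid (M i)"
    and "\<And>i. i \<in> I \<Longrightarrow> CCE (M i) (z i) = {z i, \<one>\<^bsub>M i\<^esub>}"
    and "\<And>j. j \<in> J \<Longrightarrow> monoid (A j)"
    and "\<And>j. j \<in> J \<Longrightarrow> nontrivial_monoid (A j)"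
    and "product_decomposition (product_group I M) J A f"
  shows "\<exists>!p. case p of (S, \<theta>) \<Rightarrow>
      S \<in> extensional J \<and> indexed_partition I J S \<and>
      \<theta> \<in> (\<Pi>\<^sub>E j\<in>J. iso (A j) (product_group (S j) M) \<inter> extensional (carrier (A j))) \<and>
      (\<forall>j\<in>J. \<forall>x\<in>carrier (product_group I M). \<theta> j (f j x) = restrict x (S j))"
proof -
  let ?M = "product_group I M"
  let ?h = "\<lambda>i. \<lambda>k\<in>I. if k = i then z k else \<one>\<^bsub>M k\<^esub>"
  define Z where "Z = (\<lambda>i\<in>I. z i)"
  have monM: "monoid (M i)" if "i \<in> I" for i
    using assms(1) [OF that] by (simp add: monoid_with_zero_def)
  have PM: "monoid ?M" using monM by (rule monoid_product_group)
  have MZ: "monoid_with_zero ?M Z"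
    unfolding Z_def using assms(1) by (rule monoid_with_zero_product_group)
  have Zc: "Z \<in> carrier ?M" using MZ by (rule monoid_with_zero.zero_closed)
  have fhom: "f j \<in> hom ?M (A j)" and fone: "f j \<one>\<^bsub>?M\<^esub> = \<one>\<^bsub>A j\<^esub>" if "j \<in> J" for j
    using assms(6) that by (auto simp: product_decomposition_def monoid_hom_def)
  have injF: "inj_on (\<lambda>x. \<lambda>j\<in>J. f j x) (carrier ?M)"
    using assms(6) by (simp add: product_decomposition_def iso_def bij_betw_def)
  have fsurj: "f j ` carrier ?M = carrier (A j)" if "j \<in> J" for j
    using assms(6,4) that by (rule product_decomposition_surj)
  have zero_neq_oneM: "z i \<noteq> \<one>\<^bsub>M i\<^esub>" if "i \<in> I" for i
    using assms(1,2) [OF that] by (rule nontrivial_zero_neq_one)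
  have zero_neq_oneA: "f j Z \<noteq> \<one>\<^bsub>A j\<^esub>" if "j \<in> J" for j
    using monoid_with_zero_image [OF MZ assms(4) [OF that] fhom [OF that] fsurj [OF that]]
      assms(5) [OF that] by (rule nontrivial_zero_neq_one)

  have "\<forall>j\<in>J. \<exists>e. e \<in> CCE ?M Z \<and> (\<forall>k\<in>J. k \<noteq> j \<longrightarrow> f k e = f k Z) \<and>
      (\<forall>x\<in>carrier ?M. \<forall>y\<in>carrier ?M. f j x = f j y \<longleftrightarrow> e \<otimes>\<^bsub>?M\<^esub> x = e \<otimes>\<^bsub>?M\<^esub> y)"
  proof
    fix j assume j: "j \<in> J"
    show "\<exists>e. e \<in> CCE ?M Z \<and> (\<forall>k\<in>J. k \<noteq> j \<longrightarrow> f k e = f k Z) \<and>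
      (\<forall>x\<in>carrier ?M. \<forall>y\<in>carrier ?M. f j x = f j y \<longleftrightarrow> e \<otimes>\<^bsub>?M\<^esub> x = e \<otimes>\<^bsub>?M\<^esub> y)"
      by (rule product_decomposition_idempotent [OF assms(6) MZ assms(4) j]) blast+
  qed
  from bchoice [OF this] obtain e where
    e: "\<forall>j\<in>J. e j \<in> CCE ?M Z \<and> (\<forall>k\<in>J. k \<noteq> j \<longrightarrow> f k (e j) = f k Z) \<and>
      (\<forall>x\<in>carrier ?M. \<forall>y\<in>carrier ?M. f j x = f j y \<longleftrightarrow> e j \<otimes>\<^bsub>?M\<^esub> x = e j \<otimes>\<^bsub>?M\<^esub> y)"
    ..
  have e_CCE: "e j \<in> CCE ?M Z" if "j \<in> J" for j using e that by blast
  have ec: "e j \<in> carrier ?M" if "j \<in> J" for j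
    using e_CCE [OF that] by (simp add: CCE_def CE_def)
  \<comment> \<open>The support of \<open>e j\<close>. The restriction to \<open>J\<close> fixes the
    values elsewhere, so that uniqueness can be an equality of functions.\<close>
  define S where "S = (\<lambda>j\<in>J. {i\<in>I. e j i \<noteq> z i})"
  have SI: "S j \<subseteq> I" if "j \<in> J" for j using that by (auto simp: S_def)
  \<comment> \<open>Both sides say that \<open>e j\<close> has the same product with
    \<open>x\<close> as with \<open>y\<close>.\<close>
  have ker: "f j x = f j y \<longleftrightarrow> restrict x (S j) = restrict y (S j)"
    if "j \<in> J" "x \<in> carrier ?M" "y \<in> carrier ?M" for j x y
    using e that assms(3)
      CCE_two_valued_mult_eq_iff [OF assms(1) _ e_CCE [OF that(1), unfolded Z_def] that(2,3)]
    by (simp add: S_def)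

  have hc: "?h i \<in> carrier ?M" for i
    using assms(1) monM by (auto simp: monoid.one_closed monoid_with_zero.zero_closed)
  \<comment> \<open>\<open>?h i\<close> differs from the unit only at \<open>i\<close>, because zero
    and unit of \<open>M i\<close> are distinct.\<close>
  have restrict_h: "restrict (?h i) T = restrict \<one>\<^bsub>?M\<^esub> T \<longleftrightarrow> i \<notin> T"
    if "i \<in> I" "T \<subseteq> I" for i T
    using that zero_neq_oneM by (auto simp: fun_eq_iff restrict_def)
  have onec: "\<one>\<^bsub>?M\<^esub> \<in> carrier ?M" using PM by (rule monoid.one_closed)

  have part: "indexed_partition I J S"
    unfolding indexed_partition_def
  proof (intro conjI ballI)
    show "(\<Union>j\<in>J. S j) = I"
    proof
      show "(\<Union>j\<in>J. S j) \<subseteq> I" using SI by blast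
      show "I \<subseteq> (\<Union>j\<in>J. S j)"
      proof (rule subsetI, rule ccontr)
        fix i assume i: "i \<in> I" and n: "i \<notin> (\<Union>j\<in>J. S j)"
        have "f j (?h i) = f j \<one>\<^bsub>?M\<^esub>" if j: "j \<in> J" for j
          using n j ker [OF j hc onec] restrict_h [OF i SI [OF j]] by blast
        then have "(\<lambda>j\<in>J. f j (?h i)) = (\<lambda>j\<in>J. f j \<one>\<^bsub>?M\<^esub>)" by (intro restrict_ext)
        then have "?h i = \<one>\<^bsub>?M\<^esub>" by (rule inj_onD [OF injF _ hc onec])
        from fun_cong [OF this, of i] show False using i zero_neq_oneM [OF i] by simp
      qed
    qed
    show "disjoint_family_on S J"
      unfolding disjoint_family_on_def
    proof (intro ballI impI)
      fix j k assume j: "j \<in> J" and k: "k \<in> J" and jk: "j \<noteq> k"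
      \<comment> \<open>By \<open>ker\<close> at \<open>k\<close>, this forces \<open>e j\<close> to
        vanish on \<open>S k\<close>, so \<open>S k\<close> avoids the support of
        \<open>e j\<close>.\<close>
      have "f k (e j) = f k Z" using bspec [OF e j] k jk by simp
      then have "restrict (e j) (S k) = restrict Z (S k)"
        using ker [OF k ec [OF j] Zc] by blast
      then have "e j i = z i" if "i \<in> S k" for i
        using that SI [OF k] by (auto simp: Z_def fun_eq_iff restrict_def split: if_splits)
      then show "S j \<inter> S k = {}"
        using j by (auto simp: S_def)
    qed
    fix j assume j: "j \<in> J"
    show "S j \<noteq> {}"
    proof
      assume "S j = {}"
      \<comment> \<open>All restrictions to the empty set agree, so zero and unit would coincide in
        the nontrivial \<open>A j\<close>.\<close>
      then have "f j Z = f j \<one>\<^bsub>?M\<^esub>" using ker [OF j Zc onec] by (simp add: restrict_def)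
      then show False using zero_neq_oneA [OF j] fone [OF j] by simp
    qed
  qed

  \<comment> \<open>By \<open>ker\<close>, \<open>f j\<close> and restriction to \<open>S j\<close>
    are surjections with the same fibres.\<close>
  have "\<exists>t. t \<in> iso (A j) (product_group (S j) M) \<inter> extensional (carrier (A j)) \<and>
      (\<forall>x\<in>carrier ?M. t (f j x) = restrict x (S j))" if j: "j \<in> J" for j
    using iso_of_same_kernel [OF PM fhom [OF j] fsurj [OF j]
        restrict_hom_product_group [OF SI [OF j]]
        restrict_image_product_group [OF SI [OF j] monM] ker [OF j]]
    by (metis (no_types, lifting) IntI)
  then obtain t where t: "\<And>j. j \<in> J \<Longrightarrow> t j \<in> iso (A j) (product_group (S j) M) \<inter> extensional (carrier (A j))"
    "\<And>j x. j \<in> J \<Longrightarrow> x \<in> carrier ?M \<Longrightarrow> t j (f j x) = restrict x (S j)"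
    by metis

  show ?thesis
  proof (rule ex1I [of _ "(S, restrict t J)"], goal_cases)
    case 1
    show ?case using part t by (auto simp: S_def)
  next
    case (2 p)
    obtain S' \<theta> where p: "p = (S', \<theta>)" by (cases p)
    from 2 have ext: "S' \<in> extensional J" and part': "indexed_partition I J S'"
      and th: "\<theta> \<in> (\<Pi>\<^sub>E j\<in>J. iso (A j) (product_group (S' j) M) \<inter> extensional (carrier (A j)))"
      and eq: "\<And>j x. j \<in> J \<Longrightarrow> x \<in> carrier ?M \<Longrightarrow> \<theta> j (f j x) = restrict x (S' j)"
      unfolding p by auto
    have S'I: "S' j \<subseteq> I" if "j \<in> J" for j
      using part' that by (auto simp: indexed_partition_def)
    have "S' j = S j" if j: "j \<in> J" for j
    proof -
      have inj: "inj_on (\<theta> j) (carrier (A j))"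
        using th j by (auto simp: iso_def bij_betw_def PiE_iff)
      have "i \<in> S' j \<longleftrightarrow> i \<in> S j" if i: "i \<in> I" for i
      proof -
        have "f j (?h i) \<in> carrier (A j)" "f j \<one>\<^bsub>?M\<^esub> \<in> carrier (A j)"
          using fsurj [OF j] hc onec by blast+
        \<comment> \<open>Since \<open>\<theta> j\<close> is injective, \<open>f j\<close> also has
          the fibres of restriction to \<open>S' j\<close>; testing them on \<open>?h i\<close> and
          the unit decides membership of \<open>i\<close>.\<close>
        then have "f j (?h i) = f j \<one>\<^bsub>?M\<^esub> \<longleftrightarrow> restrict (?h i) (S' j) = restrict \<one>\<^bsub>?M\<^esub> (S' j)"
          unfolding eq [OF j hc, symmetric] eq [OF j onec, symmetric]
          by (rule inj_on_eq_iff [OF inj, symmetric])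
        then show ?thesis
          using ker [OF j hc onec] restrict_h [OF i S'I [OF j]] restrict_h [OF i SI [OF j]] by blast
      qed
      then show ?thesis using SI [OF j] S'I [OF j] by blast
    qed
    then have SS: "S' = S"
      using ext by (intro extensionalityI [of _ J]) (auto simp: S_def)
    \<comment> \<open>Surjectivity of \<open>f j\<close> determines both maps on
      \<open>carrier (A j)\<close>, and extensionality fixes them outside it.\<close>
    have "\<theta> j = t j" if j: "j \<in> J" for j
    proof (rule extensionalityI [of _ "carrier (A j)"])
      show "\<theta> j \<in> extensional (carrier (A j))" "t j \<in> extensional (carrier (A j))"
        using th t(1) [OF j] j by (auto simp: PiE_iff)
      fix a assume "a \<in> carrier (A j)"
      then obtain x where "x \<in> carrier ?M" "a = f j x"
        unfolding fsurj [OF j, symmetric] by blast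
      then show "\<theta> j a = t j a" using eq [OF j] t(2) [OF j] SS by simp
    qed
    then have "\<theta> = restrict t J"
      using th by (intro extensionalityI [of _ J]) (auto simp: PiE_iff)
    then show ?case using p SS by simp
  qed
qed

end
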